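(* For each of the families (G1.1), (G1.2) (partitions $\lambda(1)=(4,3,2^3)$ and $\lambda(3)=(4,3,2^2,1^2)$ of $13$) and (G2) (partition $\lambda(2)=(4^3,1)$ of $13$) described in the context, there exist values of the complex coefficients such that $g_3=0$, i.e. $f=f_4+f_3$ and $g=g_4$ (with $f_3\ne 0$), and $$I_0(f,g)=13 .$$
   Context: All coefficients $C_{hk}^{rs}$ are complex numbers. The families below consist of local representations $f\,dy+g\,dz$ (chart $x=1$) at $[1:0:0]$, of algebraic multiplicity $3$ (i.e. all homogeneous components of $f,g$ of degree $\le 2$ vanish and $(f_3,g_3)\neq(0,0)$), of degree-3 foliation $1$-forms $A\,dx+B\,dy+C\,dz$ on $\mathbb{CP}^2$ with $A,B,C$ homogeneous of degree $4$, $xA+yB+zC=0$, $f=B(1,y,z)$, $g=C(1,y,z)$. Here $f_i,g_i$ are the homogeneous components of degree $i$. (G1.1) partitions $\lambda(1)=(4,3,2^3)$ and $\lambda(3)=(4,3,2^2,1^2)$ (which give the same local form), leading terms $\{y^4,-y^2z^2,y^3z\}$, with $(C_{03}^{31},C_{13}^{31})\neq(0,0)$: $f=-y^{2}z^{2}-C_{13}^{31}z^{4}-y^{3}-C_{30}^{31}y^{2}z-C_{21}^{31}yz^{2}+C_{03}^{22}z^{3}$, $g=y^{3}z+C_{13}^{31}yz^{3}+C_{30}^{31}y^{3}+C_{21}^{31}y^{2}z+C_{12}^{31}yz^{2}+C_{03}^{31}z^{3}$. (G1.2) partitions $\lambda(1)=(4,3,2^3)$ and $\lambda(3)=(4,3,2^2,1^2)$,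 leading terms $\{y^2z^2,-y^3z,y^4\}$, with $(C_{03}^{40},C_{13}^{40})\neq(0,0)$: $f=-y^{3}z-C_{13}^{40}z^{4}-C_{30}^{40}y^{2}z-(C_{21}^{40}+1)yz^{2}+C_{03}^{31}z^{3}$, $g=y^{4}+C_{13}^{40}yz^{3}+C_{30}^{40}y^{3}+C_{21}^{40}y^{2}z+C_{12}^{40}yz^{2}+C_{03}^{40}z^{3}$. (G2) partition $\lambda(2)=(4^3,1)$, leading terms $\{y^4,-z^4,yz^3\}$: $f=-z^{4}-C_{31}^{13}y^{2}z^{2}-y^{3}+C_{21}^{04}y^{2}z+C_{12}^{04}yz^{2}-C_{12}^{13}z^{3}$, $g=yz^{3}+C_{31}^{13}y^{3}z+C_{30}^{13}y^{3}+C_{21}^{13}y^{2}z+C_{12}^{13}yz^{2}$. $I_0(f,g)=\dim_{\mathbb{C}}\mathcal{O}_{\mathbb{C}^2,(0,0)}/\langle f,g\rangle$ is the intersection index of $f$ and $g$ at the origin. *)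

theory Defs
  imports
    "HOL-Analysis.Analysis"
    "HOL-Computational_Algebra.Computational_Algebra"
    "HOL-Algebra.Embedded_Algebras"
    "HOL-Library.Extended_Nat"
begin

subsection \<open>Polynomials in the affine chart\<close>

text \<open>
  \<open>\<complex>[y,z]\<close> is represented as \<^typ>\<open>complex poly poly\<close>, the outer variable being \<open>y\<close> and the
  inner one \<open>z\<close>.
\<close>

definition var_y :: "complex poly poly"
  where "var_y = [:0, 1:]"

definition var_z :: "complex poly poly"
  where "var_z = [:[:0, 1:]:]"

definition cst :: "complex \<Rightarrow> complex poly poly"
  where "cst c = [:[:c:]:]"

definition hom_part :: "nat \<Rightarrow> complex poly poly \<Rightarrow> complex poly poly"
  where "hom_part k p =
    (\<Sum>i\<le>k. cst (Polynomial.coeff (Polynomial.coeff p i) (k - i)) * var_y ^ i * var_z ^ (k - i))"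

text \<open>Algebraic multiplicity at the origin of the 1-form \<open>f dy + g dz\<close>.\<close>

definition has_alg_multiplicity :: "nat \<Rightarrow> complex poly poly \<Rightarrow> complex poly poly \<Rightarrow> bool"
  where "has_alg_multiplicity m f g \<longleftrightarrow>
    (\<forall>k<m. hom_part k f = 0 \<and> hom_part k g = 0) \<and> (hom_part m f, hom_part m g) \<noteq> (0, 0)"


subsection \<open>Foliation 1-forms on the projective plane\<close>

text \<open>
  \<open>\<complex>[x,y,z]\<close> is represented as \<^typ>\<open>complex poly poly poly\<close>, with \<open>x\<close> outermost and \<open>z\<close> innermost,
  so that the dehomogenization \<open>B(1,y,z)\<close> is \<open>poly B 1\<close>.
\<close>

definition homogeneous3 :: "nat \<Rightarrow> complex poly poly poly \<Rightarrow> bool"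
  where "homogeneous3 n P \<longleftrightarrow>
    (\<forall>i j k. Polynomial.coeff (Polynomial.coeff (Polynomial.coeff P i) j) k \<noteq> 0 \<longrightarrow> i + j + k = n)"

definition foliation_form ::
    "nat \<Rightarrow> complex poly poly poly \<Rightarrow> complex poly poly poly \<Rightarrow> complex poly poly poly \<Rightarrow> bool"
  where "foliation_form d A B C \<longleftrightarrow>
    homogeneous3 (d + 1) A \<and> homogeneous3 (d + 1) B \<and> homogeneous3 (d + 1) C \<and>
    [:0, 1:] * A + [:var_y:] * B + [:var_z:] * C = 0"

text \<open>
  \<open>f dy + g dz\<close> is the local representation at \<open>[1:0:0]\<close>, in the chart \<open>x = 1\<close>, of a foliation
  1-form of degree \<open>d\<close>.
\<close>

definition local_representation :: "nat \<Rightarrow> complex poly poly \<Rightarrow> complex poly poly \<Rightarrow> bool"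
  where "local_representation d f g \<longleftrightarrow>
    (\<exists>A B C. foliation_form d A B C \<and> f = poly B 1 \<and> g = poly C 1)"


subsection \<open>The three families\<close>

text \<open>The coefficient \<open>C\<^bsub>hk\<^esub>\<^bsup>rs\<^esup>\<close> is written \<open>C h k r s\<close>.\<close>

type_synonym coefficients = "nat \<Rightarrow> nat \<Rightarrow> nat \<Rightarrow> nat \<Rightarrow> complex"

type_synonym family = "coefficients \<Rightarrow> complex poly poly \<Rightarrow> complex poly poly \<Rightarrow> bool"

definition family_G1_1 :: family
  where "family_G1_1 C f g \<longleftrightarrow>
    local_representation 3 f g \<and> has_alg_multiplicity 3 f g \<and>
    (C 0 3 3 1, C 1 3 3 1) \<noteq> (0, 0) \<and>
    f = - (var_y^2 * var_z^2) - cst (C 1 3 3 1) * var_z^4 - var_y^3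
        - cst (C 3 0 3 1) * var_y^2 * var_z - cst (C 2 1 3 1) * var_y * var_z^2
        + cst (C 0 3 2 2) * var_z^3 \<and>
    g = var_y^3 * var_z + cst (C 1 3 3 1) * var_y * var_z^3 + cst (C 3 0 3 1) * var_y^3
        + cst (C 2 1 3 1) * var_y^2 * var_z + cst (C 1 2 3 1) * var_y * var_z^2
        + cst (C 0 3 3 1) * var_z^3"

definition family_G1_2 :: family
  where "family_G1_2 C f g \<longleftrightarrow>
    local_representation 3 f g \<and> has_alg_multiplicity 3 f g \<and>
    (C 0 3 4 0, C 1 3 4 0) \<noteq> (0, 0) \<and>
    f = - (var_y^3 * var_z) - cst (C 1 3 4 0) * var_z^4
        - cst (C 3 0 4 0) * var_y^2 * var_z - cst (C 2 1 4 0 + 1) * var_y * var_z^2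
        + cst (C 0 3 3 1) * var_z^3 \<and>
    g = var_y^4 + cst (C 1 3 4 0) * var_y * var_z^3 + cst (C 3 0 4 0) * var_y^3
        + cst (C 2 1 4 0) * var_y^2 * var_z + cst (C 1 2 4 0) * var_y * var_z^2
        + cst (C 0 3 4 0) * var_z^3"

definition family_G2 :: family
  where "family_G2 C f g \<longleftrightarrow>
    local_representation 3 f g \<and> has_alg_multiplicity 3 f g \<and>
    f = - (var_z^4) - cst (C 3 1 1 3) * var_y^2 * var_z^2 - var_y^3
        + cst (C 2 1 0 4) * var_y^2 * var_z + cst (C 1 2 0 4) * var_y * var_z^2
        - cst (C 1 2 1 3) * var_z^3 \<and>
    g = var_y * var_z^3 + cst (C 3 1 1 3) * var_y^3 * var_z + cst (C 3 0 1 3) * var_y^3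
        + cst (C 2 1 1 3) * var_y^2 * var_z + cst (C 1 2 1 3) * var_y * var_z^2"


subsection \<open>Intersection index at the origin\<close>

text \<open>
  The local ring \<open>\<O>\<close> of germs at the origin of holomorphic functions on \<open>\<complex>\<^sup>2\<close> is represented as the
  ring \<open>\<complex>{y,z}\<close> of convergent power series, i.e.\ of those formal power series (outer variable
  \<open>y\<close>, inner variable \<open>z\<close>) that converge absolutely on some bidisc around the origin.
\<close>

definition convergent_series :: "complex fps fps \<Rightarrow> bool"
  where "convergent_series F \<longleftrightarrow>
    (\<exists>r>0. (\<lambda>(i, j). norm (fps_nth (fps_nth F i) j) * r ^ (i + j)) summable_on
              (UNIV :: (nat \<times> nat) set))"

definition germ_ring :: "complex fps fps ring"
  where "germ_ring =
    \<lparr>carrier = {F. convergent_series F}, mult = (*), one = 1, zero = 0, add = (+)\<rparr>"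

definition germ :: "complex poly poly \<Rightarrow> complex fps fps"
  where "germ p = fps_of_poly (map_poly fps_of_poly p)"

definition local_algebra :: "complex poly poly \<Rightarrow> complex poly poly \<Rightarrow> complex fps fps set ring"
  where "local_algebra f g = germ_ring Quot (Idl\<^bsub>germ_ring\<^esub> {germ f, germ g})"

text \<open>The image of \<open>\<complex>\<close> in \<open>\<O> / \<langle>f, g\<rangle>\<close>; it is the field of scalars for the dimension below.\<close>

definition local_scalars :: "complex poly poly \<Rightarrow> complex poly poly \<Rightarrow> complex fps fps set set"
  where "local_scalars f g =
    range (\<lambda>c. (Idl\<^bsub>germ_ring\<^esub> {germ f, germ g}) +>\<^bsub>germ_ring\<^esub> germ (cst c))"

definition intersection_index :: "complex poly poly \<Rightarrow> complex poly poly \<Rightarrow> enat" (\<open>I\<^sub>0\<close>)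
  where "I\<^sub>0 f g =
    (let Q = local_algebra f g; K = local_scalars f g in
      if ring.finite_dimension Q K (carrier Q) then enat (ring.dim Q K (carrier Q)) else \<infinity>)"

end

theory Submission
  imports Defs
begin

text \<open>
  For both pairs below \<open>g\<close> is a product of forms: \<open>g = yz(y\<^sup>2 + z\<^sup>2)\<close> with
  \<open>f = -(y\<^sup>3 + z\<^sup>2(y\<^sup>2 + z\<^sup>2))\<close>, which belongs to (G1.1) and to (G2), and
  \<open>g = y(y\<^sup>3 + z\<^sup>3)\<close> with \<open>f = -(yz\<^sup>2 + z(y\<^sup>3 + z\<^sup>3))\<close>, which belongs to (G1.2).
  Intersecting \<open>f\<close> with each branch of \<open>g\<close> gives \<open>4 + 3 + 6\<close> and \<open>4 + 9\<close>.
  The dimension is computed by a normal form for the local order: a few polynomial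
  combinations of \<open>f\<close> and \<open>g\<close> rewrite every monomial, up to a monomial ideal contained in
  \<open>\<langle>f, g\<rangle>\<close>, into 13 standard monomials. The coordinates of the normal form are linear
  functionals in finitely many Taylor coefficients. They vanish on \<open>\<langle>f, g\<rangle>\<close> and are dual to
  the standard monomials, so these form a basis of the local algebra. No units have to be
  inverted, because both pairs have no common zero in \<open>\<complex>\<^sup>2\<close> besides the origin.
\<close>

subsection \<open>Convergent power series\<close>

text \<open>Each term of a summable family is bounded by its sum, which gives a Cauchy estimate with
  \<open>R = max 1 (1 / r)\<close>. Conversely, at radius \<open>1 / (2 * R)\<close> the terms are
  dominated by a product of two geometric series of ratio 1/2. Closure properties of the ring are
  then checked on coefficient bounds.\<close>

lemma convergent_series_iff:
  "convergent_series F \<longleftrightarrow>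
    (\<exists>M R. R \<ge> 1 \<and> (\<forall>i j. norm (fps_nth (fps_nth F i) j) \<le> M * R ^ (i + j)))"
proof
  assume "convergent_series F"
  then obtain r where r: "r > 0" and
    s: "(\<lambda>(i, j). norm (fps_nth (fps_nth F i) j) * r ^ (i + j)) summable_on UNIV"
    (is "?t summable_on _")
    unfolding convergent_series_def by blast
  define M where "M = infsum ?t UNIV"
  define R where "R = max 1 (1 / r)"
  have "norm (fps_nth (fps_nth F i) j) \<le> M * R ^ (i + j)" for i j
  proof -
    have "?t (i, j) = sum ?t {(i, j)}" by simp
    also have "\<dots> \<le> M"
      unfolding M_def by (rule finite_sum_le_infsum[OF s]) (use r in auto)
    finally have le: "norm (fps_nth (fps_nth F i) j) * r ^ (i + j) \<le> M" by simp
    then have M: "0 \<le> M"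
      using r by (smt (verit) mult_nonneg_nonneg norm_ge_zero zero_le_power)
    have "norm (fps_nth (fps_nth F i) j) \<le> M * (1 / r) ^ (i + j)"
      using le r by (simp add: field_simps power_divide)
    also have "\<dots> \<le> M * R ^ (i + j)"
      using M r by (intro mult_left_mono power_mono) (auto simp: R_def)
    finally show ?thesis .
  qed
  then show "\<exists>M R. R \<ge> 1 \<and> (\<forall>i j. norm (fps_nth (fps_nth F i) j) \<le> M * R ^ (i + j))"
    by (intro exI[of _ M] exI[of _ R]) (auto simp: R_def)
next
  assume "\<exists>M R. R \<ge> 1 \<and> (\<forall>i j. norm (fps_nth (fps_nth F i) j) \<le> M * R ^ (i + j))"
  then obtain M R :: real where R: "R \<ge> 1"
    and le: "\<And>i j. norm (fps_nth (fps_nth F i) j) \<le> M * R ^ (i + j)" by blast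
  have half: "((\<lambda>j. (1/2 :: real) ^ j) has_sum 2) (UNIV :: nat set)"
    using sums_nonneg_imp_has_sum[of "\<lambda>j. (1/2 :: real) ^ j" 2] geometric_sums[of "1/2 :: real"]
    by simp
  have "(\<lambda>(i, j). M * ((1/2) ^ i * (1/2 :: real) ^ j)) summable_on (UNIV :: nat set) \<times> (UNIV :: nat set)"
    unfolding case_prod_unfold
    apply (rule summable_on_cmult_right)
    apply (rule summable_on_SigmaI[where g = "\<lambda>i. (1/2) ^ i * 2"])
    using has_sum_cmult_right[OF half] summable_on_cmult_left[OF has_sum_imp_summable[OF half]]
    by auto
  then have "(\<lambda>(i, j). norm (fps_nth (fps_nth F i) j) * (1 / (2 * R)) ^ (i + j)) summable_on UNIV"
    unfolding UNIV_Times_UNIV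
  proof (rule summable_on_comparison_test, goal_cases)
    case (1 p)
    obtain i j where p: "p = (i, j)" by force
    have "norm (fps_nth (fps_nth F i) j) * (1 / (2 * R)) ^ (i + j)
        \<le> M * R ^ (i + j) * (1 / (2 * R)) ^ (i + j)"
      using R by (intro mult_right_mono le) auto
    also have "\<dots> = M * (R * (1 / (2 * R))) ^ (i + j)"
      by (simp only: power_mult_distrib mult.assoc)
    also have "\<dots> = M * ((1/2) ^ i * (1/2) ^ j)"
      using R by (simp add: power_add)
    finally show ?case using p by simp
  next
    case (2 p)
    then show ?case using R by (auto split: prod.split)
  qed
  then show "convergent_series F"
    unfolding convergent_series_def using R by (intro exI[of _ "1 / (2 * R)"]) auto
qed

lemma convergent_seriesI:
  assumes "R \<ge> 1" "\<And>i j. norm (fps_nth (fps_nth F i) j) \<le> M * R ^ (i + j)"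
  shows "convergent_series F"
  using assms convergent_series_iff by blast

text \<open>Both growth rates are enlarged to \<open>max R S\<close>; the constants are nonnegative
  because they bound the coefficient at (0, 0).\<close>

lemma convergent_series_common_bound:
  assumes "convergent_series F" "convergent_series G"
  obtains M N R where "R \<ge> 1" "M \<ge> 0" "N \<ge> 0"
    "\<And>i j. norm (fps_nth (fps_nth F i) j) \<le> M * R ^ (i + j)"
    "\<And>i j. norm (fps_nth (fps_nth G i) j) \<le> N * R ^ (i + j)"
proof -
  obtain M R where 1: "R \<ge> 1" "\<And>i j. norm (fps_nth (fps_nth F i) j) \<le> M * R ^ (i + j)"
    using assms(1) convergent_series_iff by blast
  obtain N S where 2: "S \<ge> 1" "\<And>i j. norm (fps_nth (fps_nth G i) j) \<le> N * S ^ (i + j)"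
    using assms(2) convergent_series_iff by blast
  have M: "M \<ge> 0" and N: "N \<ge> 0"
    using order_trans[OF norm_ge_zero 1(2)[of 0 0]] order_trans[OF norm_ge_zero 2(2)[of 0 0]]
    by simp_all
  have "M * R ^ k \<le> M * max R S ^ k" "N * S ^ k \<le> N * max R S ^ k" for k
    using M N 1(1) 2(1) by (auto intro!: mult_left_mono power_mono)
  then show thesis
    using 1 2 M N by (intro that[of "max R S" M N]) (auto intro: order_trans[OF 1(2)] order_trans[OF 2(2)])
qed

lemma convergent_series_add [simp]:
  assumes "convergent_series F" "convergent_series G"
  shows "convergent_series (F + G)"
  using assms
proof (rule convergent_series_common_bound)
  fix M N R :: real
  assume *: "R \<ge> 1"
    "\<And>i j. norm (fps_nth (fps_nth F i) j) \<le> M * R ^ (i + j)"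
    "\<And>i j. norm (fps_nth (fps_nth G i) j) \<le> N * R ^ (i + j)"
  show ?thesis
    by (rule convergent_seriesI[of R _ "M + N"])
      (use * in \<open>auto simp: distrib_right intro!: norm_triangle_le add_mono\<close>)
qed

text \<open>A coefficient of the product is a sum of (i + 1)(j + 1) terms, each at most M N R^(i+j).
  Since n + 1 \<le> 2^n, their number is absorbed by doubling \<open>R\<close>.\<close>

lemma convergent_series_mult [simp]:
  assumes "convergent_series F" "convergent_series G"
  shows "convergent_series (F * G)"
  using assms
proof (rule convergent_series_common_bound)
  fix M N R :: real
  assume R: "R \<ge> 1" and MN: "M \<ge> 0" "N \<ge> 0"
    and F: "\<And>i j. norm (fps_nth (fps_nth F i) j) \<le> M * R ^ (i + j)"
    and G: "\<And>i j. norm (fps_nth (fps_nth G i) j) \<le> N * R ^ (i + j)"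
  have "norm (fps_nth (fps_nth (F * G) i) j) \<le> M * N * (2 * R) ^ (i + j)" for i j
  proof -
    have "fps_nth (fps_nth (F * G) i) j =
        (\<Sum>a=0..i. \<Sum>b=0..j. fps_nth (fps_nth F a) b * fps_nth (fps_nth G (i - a)) (j - b))"
      by (simp add: fps_mult_nth fps_sum_nth)
    also have "norm \<dots> \<le> (\<Sum>a=0..i. \<Sum>b=0..j. M * N * R ^ (i + j))"
    proof (intro order_trans[OF norm_sum] sum_mono)
      fix a b assume "a \<in> {0..i}" "b \<in> {0..j}"
      \<comment> \<open>In this range natural subtraction is exact, so the two exponents recombine
        to \<open>i + j\<close>, independently of \<open>a\<close> and \<open>b\<close>.\<close>
      then have e: "(a + b) + (i - a + (j - b)) = i + j" by simp
      have "norm (fps_nth (fps_nth F a) b * fps_nth (fps_nth G (i - a)) (j - b))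
          \<le> (M * R ^ (a + b)) * (N * R ^ (i - a + (j - b)))"
        unfolding norm_mult using R MN by (intro mult_mono F G) auto
      also have "\<dots> = M * N * R ^ ((a + b) + (i - a + (j - b)))"
        by (simp only: power_add mult_ac)
      finally show "norm (fps_nth (fps_nth F a) b * fps_nth (fps_nth G (i - a)) (j - b))
          \<le> M * N * R ^ (i + j)" unfolding e .
    qed
    also have "\<dots> = (real (i + 1) * real (j + 1)) * (M * N * R ^ (i + j))"
      by simp
    also have "\<dots> \<le> (2 ^ i * 2 ^ j) * (M * N * R ^ (i + j))"
    proof -
      have "real (n + 1) \<le> 2 ^ n" for n :: nat
        by (induction n) auto
      then show ?thesis
        using R MN by (intro mult_right_mono mult_mono) auto
    qed
    finally show ?thesis by (simp add: power_mult_distrib power_add mult_ac)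
  qed
  then show ?thesis
    using R by (intro convergent_seriesI[of "2 * R"]) auto
qed

lemma convergent_series_finite:
  assumes "finite {(i, j). fps_nth (fps_nth F i) j \<noteq> 0}"
  shows "convergent_series F"
proof -
  define S where "S = {(i, j). fps_nth (fps_nth F i) j \<noteq> 0}"
  have "norm (fps_nth (fps_nth F i) j) \<le> (\<Sum>(i, j)\<in>S. norm (fps_nth (fps_nth F i) j))" for i j
  proof (cases "(i, j) \<in> S")
    case True
    then show ?thesis
      using member_le_sum[of "(i, j)" S "\<lambda>(i, j). norm (fps_nth (fps_nth F i) j)"] assms
      by (auto simp: S_def)
  next
    case False
    then show ?thesis by (auto simp: S_def intro!: sum_nonneg)
  qed
  then show ?thesis by (intro convergent_seriesI[of 1]) auto
qed

text \<open>Shifts appear as cofactors in the remainder of a truncation; this lemma and the next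
  keep those cofactors inside the ring of germs.\<close>

lemma convergent_series_fps_shift [simp]:
  assumes "convergent_series F"
  shows "convergent_series (fps_shift m F)"
proof -
  obtain M R where R: "R \<ge> 1" "\<And>i j. norm (fps_nth (fps_nth F i) j) \<le> M * R ^ (i + j)"
    using assms convergent_series_iff by blast
  have "norm (fps_nth (fps_nth (fps_shift m F) i) j) \<le> (M * R ^ m) * R ^ (i + j)" for i j
    using R(2)[of "i + m" j] by (simp add: power_add mult_ac)
  then show ?thesis by (rule convergent_seriesI[OF R(1)])
qed

lemma convergent_series_const_fps_shift [simp]:
  assumes "convergent_series F"
  shows "convergent_series (fps_const (fps_shift n (fps_nth F k)))"
proof -
  obtain M R where R: "R \<ge> 1" "\<And>i j. norm (fps_nth (fps_nth F i) j) \<le> M * R ^ (i + j)"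
    using assms convergent_series_iff by blast
  have M: "M \<ge> 0"
    using order_trans[OF norm_ge_zero R(2)[of 0 0]] by simp
  have "norm (fps_nth (fps_nth (fps_const (fps_shift n (fps_nth F k))) i) j)
      \<le> (M * R ^ (k + n)) * R ^ (i + j)" for i j
    using R(2)[of k "j + n"] M R(1) by (cases i) (simp_all add: power_add mult_ac)
  then show ?thesis by (rule convergent_seriesI[OF R(1)])
qed


lemma convergent_series_uminus [simp]: "convergent_series (- F) \<longleftrightarrow> convergent_series F"
  by (simp add: convergent_series_def)

section \<open>Constants and monomials as germs\<close>

definition germ_const :: "complex \<Rightarrow> complex fps fps"
  where "germ_const c = fps_const (fps_const c)"

text \<open>The monomial y^i z^j; the power of z is wrapped as a constant because z is the inner
  variable.\<close>

definition germ_mon :: "nat \<Rightarrow> nat \<Rightarrow> complex fps fps"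
  where "germ_mon i j = fps_const (fps_X ^ j) * fps_X ^ i"

lemma germ_const_simps:
  "germ_const 0 = 0" "germ_const 1 = 1" "germ_const (a + b) = germ_const a + germ_const b"
  "germ_const (a - b) = germ_const a - germ_const b" "germ_const (- a) = - germ_const a"
  "germ_const (a * b) = germ_const a * germ_const b"
  by (simp_all add: germ_const_def)

lemma nth_germ_const_mult [simp]:
  "fps_nth (fps_nth (germ_const c * F) i) j = c * fps_nth (fps_nth F i) j"
  by (simp add: germ_const_def)

lemma germ_mon_0_0 [simp]: "germ_mon 0 0 = 1"
  by (simp add: germ_mon_def)

lemma germ_mon_mult: "germ_mon i j * germ_mon k l = germ_mon (i + k) (j + l)"
  by (simp add: germ_mon_def power_add mult_ac flip: fps_const_mult)

lemma germ_mon_mult_left: "germ_mon i j * (germ_mon k l * F) = germ_mon (i + k) (j + l) * F"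
  by (simp add: germ_mon_mult flip: mult.assoc)

lemma nth_mult_germ_mon [simp]:
  "fps_nth (fps_nth (F * germ_mon k l) i) j =
    (if i < k \<or> j < l then 0 else fps_nth (fps_nth F (i - k)) (j - l))"
proof -
  have *: "F * germ_mon k l = fps_const (fps_X ^ l) * F * fps_X ^ k"
    by (simp only: germ_mon_def mult_ac)
  show ?thesis
    unfolding * by (simp add: fps_X_power_mult_right_nth fps_X_power_mult_nth)
qed

lemma nth_germ_mon [simp]:
  "fps_nth (fps_nth (germ_mon k l) i) j = (if i = k \<and> j = l then 1 else 0)"
  using nth_mult_germ_mon[of 1 k l i j] by (auto simp: fps_one_nth)

lemma nth_germ_const [simp]:
  "fps_nth (fps_nth (germ_const c) i) j = (if i = 0 \<and> j = 0 then c else 0)"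
  by (simp add: germ_const_def)

lemma nth_sum_list_germ_mon:
  assumes "distinct B"
  shows "fps_nth (fps_nth (\<Sum>(i, j)\<leftarrow>B. germ_const (c (i, j)) * germ_mon i j) a) b
    = (if (a, b) \<in> set B then c (a, b) else 0)"
  using assms by (induction B) (auto simp del: nth_mult_germ_mon split: if_splits)

lemma convergent_series_germ_const [simp]: "convergent_series (germ_const c)"
  by (rule convergent_series_finite, rule finite_subset[of _ "{(0, 0)}"]) (auto split: if_splits)

lemma convergent_series_germ_mon [simp]: "convergent_series (germ_mon i j)"
  by (rule convergent_series_finite, rule finite_subset[of _ "{(i, j)}"]) (auto split: if_splits)

lemma convergent_series_0_1 [simp]: "convergent_series 0" "convergent_series 1"
  using convergent_series_germ_const[of 0] convergent_series_germ_const[of 1] by (simp_all add: germ_const_simps)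

lemma nth_germ [simp]: "fps_nth (fps_nth (germ p) i) j = Polynomial.coeff (Polynomial.coeff p i) j"
  by (simp add: germ_def coeff_map_poly)

lemma convergent_series_germ [simp]: "convergent_series (germ p)"
proof (rule convergent_series_finite, rule finite_subset)
  show "{(i, j). fps_nth (fps_nth (germ p) i) j \<noteq> 0}
      \<subseteq> (SIGMA i:{..Polynomial.degree p}. {..Polynomial.degree (Polynomial.coeff p i)})"
    by (auto intro!: le_degree)
qed auto

lemma germ_cst: "germ (cst c) = germ_const c"
  by (intro fps_ext) (auto simp: cst_def coeff_pCons split: nat.split)

section \<open>Expansion with remainder in two variables\<close>

lemma fps_const_sum: "fps_const (\<Sum>x\<in>A. f x) = (\<Sum>x\<in>A. fps_const (f x))"
  by (induction A rule: infinite_finite_induct) (simp_all flip: fps_const_add)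

text \<open>The lowest term is split off repeatedly. The coefficient ring is left general so that
  the lemma serves both for y, with series in z as coefficients, and for z.\<close>

lemma fps_expand:
  fixes f :: "'a :: comm_ring_1 fps"
  shows "f = (\<Sum>i<m. fps_const (fps_nth f i) * fps_X ^ i) + fps_shift m f * fps_X ^ m"
proof (induction m)
  case (Suc m)
  have "fps_shift m f = fps_const (fps_nth f m) + fps_shift (Suc m) f * fps_X"
    by (rule fps_ext) (auto simp: fps_X_mult_right_nth)
  then have "fps_shift m f * fps_X ^ m
      = fps_const (fps_nth f m) * fps_X ^ m + fps_shift (Suc m) f * fps_X ^ Suc m"
    by (simp add: algebra_simps)
  then show ?case using Suc by (simp add: add.assoc)
qed simp

text \<open>\<open>fps_expand\<close> is applied in y up to order \<open>m\<close>, then in z to the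
  i-th coefficient up to order \<open>n i\<close>. The remainder consists of multiples of the corner
  monomials y^i z^(n i) and y^m.\<close>

lemma staircase_expand:
  "F = (\<Sum>i<m. \<Sum>j<n i. germ_const (fps_nth (fps_nth F i) j) * germ_mon i j)
    + ((\<Sum>i<m. fps_const (fps_shift (n i) (fps_nth F i)) * germ_mon i (n i)) + fps_shift m F * germ_mon m 0)"
proof -
  have "fps_const (fps_nth F i) * fps_X ^ i =
      (\<Sum>j<n i. germ_const (fps_nth (fps_nth F i) j) * germ_mon i j)
      + fps_const (fps_shift (n i) (fps_nth F i)) * germ_mon i (n i)" for i
  proof -
    have "fps_const (fps_nth F i) = (\<Sum>j<n i. germ_const (fps_nth (fps_nth F i) j) * fps_const (fps_X ^ j))
        + fps_const (fps_shift (n i) (fps_nth F i)) * fps_const (fps_X ^ n i)"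
      unfolding germ_const_def
      by (subst fps_expand[of "fps_nth F i" "n i"]) (simp add: fps_const_sum flip: fps_const_add fps_const_mult)
    then show ?thesis
      by (simp add: germ_mon_def distrib_right sum_distrib_right mult.assoc)
  qed
  then show ?thesis
    by (subst fps_expand[of F m]) (simp add: sum.distrib add.assoc germ_mon_def)
qed

subsection \<open>The local algebra\<close>

text \<open>The projection carries combinations over \<open>K\<close> to combinations over its
  image, so \<open>indep\<close> and \<open>spans\<close> say that the classes of \<open>Us\<close>
  are independent and generate the quotient. Properness of \<open>I\<close> ensures that the image
  of \<open>K\<close> is again a subfield.\<close>

lemma (in ideal) quotient_dimension:
  assumes K: "subfield K R" and Us: "set Us \<subseteq> carrier R" and one: "\<one> \<notin> I"
    and indep: "\<And>Ks. \<lbrakk>set Ks \<subseteq> K; length Ks = length Us; combine Ks Us \<in> I\<rbrakk> \<Longrightarrow> set Ks \<subseteq> {\<zero>}"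
    and spans: "\<And>x. x \<in> carrier R \<Longrightarrow> \<exists>Ks. set Ks \<subseteq> K \<and> x \<ominus> combine Ks Us \<in> I"
  defines "Q \<equiv> R Quot I" and "K' \<equiv> (+>) I ` K"
  shows "ring.finite_dimension Q K' (carrier Q) \<and> ring.dim Q K' (carrier Q) = length Us"
proof -
  have Q_zero: "\<zero>\<^bsub>Q\<^esub> = I" and Q_car: "carrier Q = (+>) I ` carrier R"
    unfolding Q_def FactRing_def by (auto simp: A_RCOSETS_def')
  interpret h: ring_hom_ring R Q "(+>) I"
    unfolding Q_def by (rule rcos_ring_hom_ring)
  have K_car: "K \<subseteq> carrier R"
    using K by (rule subfieldE)
  have zero_iff: "I +> x = \<zero>\<^bsub>Q\<^esub> \<longleftrightarrow> x \<in> I" if "x \<in> carrier R" for x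
    using rcos_const_imp_mem[OF that] a_rcos_zero[OF is_ideal, of x] unfolding Q_zero by metis
  have K': "subfield K' Q"
    unfolding K'_def using one zero_iff[OF one_closed] h.hom_one
    by (intro h.img_is_subfield(2) K) auto
  define Vs where "Vs = map ((+>) I) Us"
  have Vs: "set Vs \<subseteq> carrier Q"
    using Us by (auto simp: Vs_def)
  have lift: "\<exists>Ks. set Ks \<subseteq> K \<and> Ls = map ((+>) I) Ks" if "set Ls \<subseteq> K'" for Ls
  proof -
    have "Ls \<in> lists ((+>) I ` K)" using that by (auto simp: K'_def)
    then show ?thesis unfolding lists_image by auto
  qed
  have combine: "h.S.combine (map ((+>) I) Ks) Vs = I +> combine Ks Us" if "set Ks \<subseteq> K" for Ks
    unfolding Vs_def using that K_car Us by (intro h.combine_hom) auto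
  have ind: "h.S.independent K' Vs"
  proof (rule h.S.trivial_combine_imp_independent[OF K' Vs])
    fix Ls assume Ls: "set Ls \<subseteq> K'" and 0: "h.S.combine Ls Vs = \<zero>\<^bsub>Q\<^esub>"
    obtain Ks where Ks: "set Ks \<subseteq> K" "Ls = map ((+>) I) Ks"
      using lift[OF Ls] by blast
    have car: "set Ks \<subseteq> carrier R" using Ks(1) K_car by blast
    \<comment> \<open>Independence must be tested on coefficient lists of any length, while
      \<open>indep\<close> speaks of lists as long as \<open>Us\<close>; cutting off or padding with
      zeros leaves the combination unchanged.\<close>
    obtain Ks' where Ks': "set (take (length Us) Ks) \<subseteq> set Ks'"
        "set Ks' \<subseteq> set (take (length Us) Ks) \<union> {\<zero>}" "length Ks' = length Us"
        "combine Ks' Us = combine Ks Us"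
      using combine_normalize[OF car Us refl] by blast
    have "combine Ks Us \<in> I"
      using 0 combine[OF Ks(1)] zero_iff[OF combine_in_carrier[OF car Us]] Ks(2) by simp
    moreover have "set Ks' \<subseteq> K"
      using Ks'(2) Ks(1) subringE(2)[OF subfieldE(1)[OF K]] set_take_subset[of "length Us" Ks] by blast
    ultimately have "set Ks' \<subseteq> {\<zero>}"
      using indep Ks'(3,4) by simp
    then show "set (take (length Vs) Ls) \<subseteq> {\<zero>\<^bsub>Q\<^esub>}"
      using Ks'(1) h.hom_zero unfolding Ks(2) Vs_def take_map by auto
  qed
  have "h.S.Span K' Vs = carrier Q"
  proof
    show "h.S.Span K' Vs \<subseteq> carrier Q"
      using h.S.Span_in_carrier[OF _ Vs] subfieldE(3)[OF K'] by blast
    show "carrier Q \<subseteq> h.S.Span K' Vs"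
    proof
      fix q assume "q \<in> carrier Q"
      then obtain x where x: "x \<in> carrier R" "q = I +> x"
        unfolding Q_car by blast
      obtain Ks where Ks: "set Ks \<subseteq> K" "x \<ominus> combine Ks Us \<in> I"
        using spans[OF x(1)] by blast
      have car: "combine Ks Us \<in> carrier R"
        using Ks(1) K_car Us by (intro combine_in_carrier) auto
      have "q = I +> combine Ks Us"
        using quotient_eq_iff_same_a_r_cos[OF is_ideal x(1) car] Ks(2) x(2) by simp
      then have "q = h.S.combine (map ((+>) I) Ks) Vs"
        using combine[OF Ks(1)] by simp
      moreover have "set (map ((+>) I) Ks) \<subseteq> K'"
        unfolding K'_def set_map using Ks(1) by (rule image_mono)
      ultimately show "q \<in> h.S.Span K' Vs"
        unfolding h.S.Span_eq_combine_set[OF K' Vs] by blast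
    qed
  qed
  then have dim: "h.S.dimension (length Us) K' (carrier Q)"
    using h.S.dimension_independent[OF ind] by (simp add: Vs_def)
  show ?thesis
    using h.S.finite_dimensionI[OF dim] h.S.dimI[OF K' dim] unfolding over_def by (rule conjI)
qed

section \<open>The ring of germs and its ideals with two generators\<close>

lemma germ_ring_simps [simp]:
  "carrier germ_ring = {F. convergent_series F}" "mult germ_ring = (*)" "one germ_ring = 1"
  "zero germ_ring = 0" "add germ_ring = (+)"
  by (simp_all add: germ_ring_def)

lemma cring_germ_ring: "cring germ_ring"
proof (rule cringI)
  show "abelian_group germ_ring"
  proof (rule abelian_groupI)
    fix F assume "F \<in> carrier germ_ring"
    then show "\<exists>G\<in>carrier germ_ring. G \<oplus>\<^bsub>germ_ring\<^esub> F = \<zero>\<^bsub>germ_ring\<^esub>"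
      by (intro bexI[of _ "- F"]) auto
  qed (auto simp: add_ac)
  show "comm_monoid germ_ring"
    by (rule comm_monoidI) (auto simp: mult_ac)
qed (auto simp: distrib_right)

interpretation germs: cring germ_ring
  by (rule cring_germ_ring)

lemma germs_a_inv: "convergent_series F \<Longrightarrow> \<ominus>\<^bsub>germ_ring\<^esub> F = - F"
  by (rule germs.minus_equality) auto

lemma germs_minus: "\<lbrakk>convergent_series F; convergent_series G\<rbrakk> \<Longrightarrow> F \<ominus>\<^bsub>germ_ring\<^esub> G = F - G"
  by (simp add: a_minus_def germs_a_inv)

text \<open>For convergent \<open>u\<close> and \<open>v\<close> this is the ideal they generate,
  see \<open>Idl_eq_combinations\<close>; with explicit cofactors, membership becomes a
  computation.\<close>

definition combinations :: "complex fps fps \<Rightarrow> complex fps fps \<Rightarrow> complex fps fps set"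
  where "combinations u v = {a * u + b * v | a b. convergent_series a \<and> convergent_series b}"

lemma combinationsI:
  assumes "convergent_series a" "convergent_series b" "w = a * u + b * v"
  shows "w \<in> combinations u v"
  using assms unfolding combinations_def by blast

lemma combinations_add:
  assumes "x \<in> combinations u v" "y \<in> combinations u v"
  shows "x + y \<in> combinations u v"
proof -
  obtain a b c d where "x = a * u + b * v" "y = c * u + d * v" "convergent_series a"
    "convergent_series b" "convergent_series c" "convergent_series d"
    using assms unfolding combinations_def by blast
  then show ?thesis
    by (intro combinationsI[of "a + c" "b + d"]) (auto simp: algebra_simps)
qed

lemma combinations_mult:
  assumes "x \<in> combinations u v" "convergent_series c"
  shows "c * x \<in> combinations u v"
proof -
  obtain a b where "x = a * u + b * v" "convergent_series a" "convergent_series b"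
    using assms unfolding combinations_def by blast
  then show ?thesis using assms(2)
    by (intro combinationsI[of "c * a" "c * b"]) (auto simp: algebra_simps)
qed

lemma combinations_0: "0 \<in> combinations u v"
  by (rule combinationsI[of 0 0]) auto

lemma combinations_diff:
  assumes "x \<in> combinations u v" "y \<in> combinations u v"
  shows "x - y \<in> combinations u v"
  using combinations_add[OF assms(1) combinations_mult[OF assms(2), of "-1"]] by simp

lemma combinations_sum:
  assumes "\<And>i. i \<in> A \<Longrightarrow> x i \<in> combinations u v"
  shows "sum x A \<in> combinations u v"
  using assms
  by (induction A rule: infinite_finite_induct) (auto intro: combinations_0 combinations_add)

text \<open>By \<open>staircase_expand\<close> the difference is a sum of multiples of corner
  monomials with convergent cofactors. Modulo the ideal, only the finitely many coefficients below
  the staircase matter.\<close>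

lemma staircase_remainder:
  assumes F: "convergent_series F"
    and corners: "\<And>i. i < m \<Longrightarrow> germ_mon i (n i) \<in> combinations u v" "germ_mon m 0 \<in> combinations u v"
  shows "F - (\<Sum>i<m. \<Sum>j<n i. germ_const (fps_nth (fps_nth F i) j) * germ_mon i j) \<in> combinations u v"
proof -
  have "F - (\<Sum>i<m. \<Sum>j<n i. germ_const (fps_nth (fps_nth F i) j) * germ_mon i j)
      = (\<Sum>i<m. fps_const (fps_shift (n i) (fps_nth F i)) * germ_mon i (n i)) + fps_shift m F * germ_mon m 0"
    by (rule iffD2[OF diff_eq_eq trans[OF staircase_expand add.commute]])
  also have "\<dots> \<in> combinations u v"
    using F by (intro combinations_add combinations_sum combinations_mult corners) auto
  finally show ?thesis .
qed

lemma Idl_eq_combinations: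
  assumes "convergent_series u" "convergent_series v"
  shows "Idl\<^bsub>germ_ring\<^esub> {u, v} = combinations u v"
proof
  have sub: "combinations u v \<subseteq> carrier germ_ring"
    using assms by (auto simp: combinations_def)
  have "ideal (combinations u v) germ_ring"
  proof (rule idealI[OF germs.ring_axioms])
    show "subgroup (combinations u v) (add_monoid germ_ring)"
    proof (rule group.subgroupI[OF germs.a_group])
      fix x assume x: "x \<in> combinations u v"
      then have "inv\<^bsub>add_monoid germ_ring\<^esub> x = - x"
        using germs_a_inv[of x] sub by (auto simp: a_inv_def)
      then show "inv\<^bsub>add_monoid germ_ring\<^esub> x \<in> combinations u v"
        using combinations_mult[OF x, of "-1"] by simp
    next
      show "combinations u v \<noteq> {}"
        using combinations_0 by blast
    qed (use sub combinations_add in auto)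
  qed (use combinations_mult in \<open>auto simp: mult.commute\<close>)
  moreover have "u \<in> combinations u v" "v \<in> combinations u v"
    by (auto intro: combinationsI[of 1 0] combinationsI[of 0 1])
  ultimately show "Idl\<^bsub>germ_ring\<^esub> {u, v} \<subseteq> combinations u v"
    by (intro germs.genideal_minimal) auto
next
  interpret I: ideal "Idl\<^bsub>germ_ring\<^esub> {u, v}" germ_ring
    using assms by (intro germs.genideal_ideal) auto
  have uv: "u \<in> Idl\<^bsub>germ_ring\<^esub> {u, v}" "v \<in> Idl\<^bsub>germ_ring\<^esub> {u, v}"
    using germs.genideal_self[of "{u, v}"] assms by auto
  have "a * u + b * v \<in> Idl\<^bsub>germ_ring\<^esub> {u, v}" if "convergent_series a" "convergent_series b" for a b
    using I.a_closed[OF I.I_l_closed[OF uv(1)] I.I_l_closed[OF uv(2)], of a b] that by simp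
  then show "combinations u v \<subseteq> Idl\<^bsub>germ_ring\<^esub> {u, v}"
    by (auto simp: combinations_def)
qed

text \<open>The image of this subfield in the quotient is \<open>local_scalars\<close>, since
  \<open>germ (cst c)\<close> is \<open>germ_const c\<close>.\<close>

lemma subfield_germ_const: "subfield (range germ_const) germ_ring"
proof -
  have sub: "subcring (range germ_const) germ_ring"
  proof (rule germs.subcringI, rule germs.subringI)
    fix h assume "h \<in> range germ_const"
    then show "\<ominus>\<^bsub>germ_ring\<^esub> h \<in> range germ_const"
      by (auto simp: germs_a_inv simp flip: germ_const_simps(5))
  next
    show "\<one>\<^bsub>germ_ring\<^esub> \<in> range germ_const"
      by (auto simp flip: germ_const_simps(2))
  qed (auto simp: mult.commute simp flip: germ_const_simps(3,6))
  have inj: "germ_const c = 0 \<longleftrightarrow> c = 0" for c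
    by (simp add: germ_const_def)
  show ?thesis
  proof (rule germs.subfieldI[OF sub])
    show "Units (germ_ring\<lparr>carrier := range germ_const\<rparr>) = range germ_const - {\<zero>\<^bsub>germ_ring\<^esub>}"
    proof (intro equalityI subsetI)
      fix x assume "x \<in> range germ_const - {\<zero>\<^bsub>germ_ring\<^esub>}"
      then obtain c where "x = germ_const c" "c \<noteq> 0"
        using inj by auto
      moreover from this have "germ_const (inverse c) * germ_const c = 1"
        by (simp add: germ_const_simps flip: germ_const_simps(6))
      ultimately show "x \<in> Units (germ_ring\<lparr>carrier := range germ_const\<rparr>)"
        by (auto simp: Units_def mult.commute)
    qed (auto simp: Units_def)
  qed
qed

lemma germs_combine:
  "ring.combine germ_ring (map (\<lambda>p. germ_const (c p)) B) (map (\<lambda>(i, j). germ_mon i j) B)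
    = (\<Sum>(i, j)\<leftarrow>B. germ_const (c (i, j)) * germ_mon i j)"
  by (induction B) auto

text \<open>\<open>\<phi>\<close> is a coordinate system modulo the ideal: by \<open>vanish\<close>
  and \<open>dual\<close>, a combination of the monomials in \<open>B\<close> that lies in the ideal
  has only zero coefficients, and \<open>spans\<close> makes these monomials generate. The ideal is
  proper because both generators vanish at the origin. In \<open>vanish\<close> the cofactors may be
  arbitrary formal series.\<close>

lemma intersection_index_eqI:
  assumes B: "distinct B"
    and origin: "Polynomial.coeff (Polynomial.coeff f 0) 0 = 0" "Polynomial.coeff (Polynomial.coeff g 0) 0 = 0"
    and dual: "\<And>c q. q \<in> set B \<Longrightarrow> \<phi> (\<Sum>(i, j)\<leftarrow>B. germ_const (c (i, j)) * germ_mon i j) q = c q"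
    and vanish: "\<And>a b q. q \<in> set B \<Longrightarrow> \<phi> (a * germ f + b * germ g) q = 0"
    and spans: "\<And>F. convergent_series F \<Longrightarrow>
        F - (\<Sum>(i, j)\<leftarrow>B. germ_const (\<phi> F (i, j)) * germ_mon i j) \<in> combinations (germ f) (germ g)"
  shows "I\<^sub>0 f g = enat (length B)"
proof -
  define I where "I = Idl\<^bsub>germ_ring\<^esub> {germ f, germ g}"
  have I: "I = combinations (germ f) (germ g)"
    unfolding I_def by (simp add: Idl_eq_combinations)
  interpret I: ideal I germ_ring
    unfolding I_def by (intro germs.genideal_ideal) auto
  have one: "1 \<notin> I"
  proof
    assume "1 \<in> I"
    then obtain a b where "1 = a * germ f + b * germ g"
      by (auto simp: I combinations_def)
    then have "fps_nth (fps_nth 1 0) 0 = fps_nth (fps_nth (a * germ f + b * germ g) 0) 0"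
      by simp
    then show False using origin by simp
  qed
  let ?Us = "map (\<lambda>(i, j). germ_mon i j) B"
  have "ring.finite_dimension (germ_ring Quot I) ((+>\<^bsub>germ_ring\<^esub>) I ` range germ_const) (carrier (germ_ring Quot I)) \<and>
    ring.dim (germ_ring Quot I) ((+>\<^bsub>germ_ring\<^esub>) I ` range germ_const) (carrier (germ_ring Quot I)) = length ?Us"
  proof (rule I.quotient_dimension[OF subfield_germ_const])
    show "set ?Us \<subseteq> carrier germ_ring" by auto
    show "\<one>\<^bsub>germ_ring\<^esub> \<notin> I" using one by simp
  next
    fix Ks assume Ks: "set Ks \<subseteq> range germ_const" "length Ks = length ?Us"
      and mem: "ring.combine germ_ring Ks ?Us \<in> I"
    \<comment> \<open>As \<open>B\<close> is distinct, a coefficient list of the same length is the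
      list of values of a function on \<open>B\<close>.\<close>
    obtain c where c: "Ks = map (\<lambda>p. germ_const (c p)) B"
    proof -
      have "Ks \<in> lists (range germ_const)" using Ks(1) by auto
      then obtain cs where cs: "Ks = map germ_const cs"
        unfolding lists_image by auto
      have *: "cs = map (\<lambda>p. the (map_of (zip B cs) p)) B"
        using B Ks(2) unfolding cs by (intro nth_equalityI) (auto simp: map_of_zip_nth)
      show thesis
        by (rule that[of "\<lambda>p. the (map_of (zip B cs) p)"], unfold cs, subst *) simp
    qed
    have "c q = 0" if "q \<in> set B" for q
      using mem dual[OF that, of c] vanish[OF that]
      by (auto simp: I combinations_def c germs_combine)
    then show "set Ks \<subseteq> {\<zero>\<^bsub>germ_ring\<^esub>}"
      by (auto simp: c germ_const_simps)
  next
    fix F assume "F \<in> carrier germ_ring"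
    then have F: "convergent_series F" by simp
    have "convergent_series (\<Sum>(i, j)\<leftarrow>B. germ_const (\<phi> F (i, j)) * germ_mon i j)"
      by (induction B) auto
    then show "\<exists>Ks. set Ks \<subseteq> range germ_const \<and> F \<ominus>\<^bsub>germ_ring\<^esub> ring.combine germ_ring Ks ?Us \<in> I"
      using spans[OF F] F
      by (intro exI[of _ "map (\<lambda>p. germ_const (\<phi> F p)) B"]) (auto simp: germs_combine germs_minus I)
  qed
  then show ?thesis
    by (simp add: intersection_index_def local_algebra_def local_scalars_def germ_cst I_def image_image Let_def)
qed

subsection \<open>Two pairs with intersection index 13\<close>

definition poly_mon :: "nat \<Rightarrow> nat \<Rightarrow> complex poly poly"
  where "poly_mon i j = var_y ^ i * var_z ^ j"

lemma poly_mon_eq_monom: "poly_mon i j = Polynomial.monom (Polynomial.monom 1 j) i"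
proof -
  have y: "var_y = Polynomial.monom 1 1" and z: "var_z = Polynomial.monom (Polynomial.monom 1 1) 0"
    by (simp_all add: var_y_def var_z_def Polynomial.monom_altdef)
  show ?thesis
    unfolding poly_mon_def y z monom_power mult_monom by simp
qed

lemma coeff_poly_mon [simp]:
  "Polynomial.coeff (Polynomial.coeff (poly_mon k l) i) j = (if i = k \<and> j = l then 1 else 0)"
  by (auto simp: poly_mon_eq_monom)

lemma var_mult_poly_mon [simp]:
  "var_y * poly_mon i j = poly_mon (Suc i) j" "poly_mon i j * var_y = poly_mon (Suc i) j"
  "var_z * poly_mon i j = poly_mon i (Suc j)" "poly_mon i j * var_z = poly_mon i (Suc j)"
  by (simp_all add: poly_mon_def)

lemma cst_0_1 [simp]: "cst 0 = 0" "cst 1 = 1"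
  by (simp_all add: cst_def one_pCons)

lemma germ_poly_mon [simp]: "germ (poly_mon i j) = germ_mon i j"
  by (intro fps_ext) simp

lemma germ_add [simp]: "germ (p + q) = germ p + germ q"
  by (intro fps_ext) simp

lemma germ_diff [simp]: "germ (p - q) = germ p - germ q"
  by (intro fps_ext) simp

lemma germ_uminus [simp]: "germ (- p) = - germ p"
  by (intro fps_ext) simp

lemma coeff_hom_part [simp]:
  "Polynomial.coeff (Polynomial.coeff (hom_part k p) i) j =
    (if i + j = k then Polynomial.coeff (Polynomial.coeff p i) j else 0)"
proof -
  have "cst c * var_y ^ a * var_z ^ b = cst c * poly_mon a b" for a b c
    by (simp add: poly_mon_def mult.assoc)
  then have "Polynomial.coeff (Polynomial.coeff (hom_part k p) i) j =
      (\<Sum>a\<le>k. if a = i then (if k - a = j then Polynomial.coeff (Polynomial.coeff p a) (k - a) else 0) else 0)"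
    unfolding hom_part_def coeff_sum by (intro sum.cong refl) (auto simp: cst_def)
  also have "\<dots> = (if i + j = k then Polynomial.coeff (Polynomial.coeff p i) j else 0)"
    by (subst sum.delta) auto
  finally show ?thesis .
qed

lemma hom_part_add [simp]: "hom_part k (p + q) = hom_part k p + hom_part k q"
  and hom_part_diff [simp]: "hom_part k (p - q) = hom_part k p - hom_part k q"
  and hom_part_uminus [simp]: "hom_part k (- p) = - hom_part k p"
  and hom_part_poly_mon [simp]: "hom_part k (poly_mon i j) = (if i + j = k then poly_mon i j else 0)"
  by (auto intro!: poly_eqI)

section \<open>The two pairs and their places in the families\<close>

definition f1 :: "complex poly poly" where "f1 = - (poly_mon 3 0 + poly_mon 2 2 + poly_mon 0 4)"
definition g1 :: "complex poly poly" where "g1 = poly_mon 3 1 + poly_mon 1 3"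
definition f2 :: "complex poly poly" where "f2 = - (poly_mon 1 2 + poly_mon 3 1 + poly_mon 0 4)"
definition g2 :: "complex poly poly" where "g2 = poly_mon 4 0 + poly_mon 1 3"

lemma poly_mon_ne_0 [simp]: "poly_mon i j \<noteq> 0"
  by (simp add: poly_mon_eq_monom)

lemma local_representation_1: "local_representation 3 f1 g1"
  unfolding local_representation_def foliation_form_def homogeneous3_def f1_def g1_def
  \<comment> \<open>Listed by powers of x, \<open>B\<close> and \<open>C\<close> are the
    homogenizations of \<open>f1\<close> and \<open>g1\<close> to degree 4; then xA + yB + zC = 0
    forces A = y^4.\<close>
  by (rule exI[of _ "[:poly_mon 4 0:]"], rule exI[of _ "[:- (poly_mon 2 2 + poly_mon 0 4), - poly_mon 3 0:]"],
      rule exI[of _ "[:poly_mon 3 1 + poly_mon 1 3:]"])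
    (auto simp: coeff_pCons algebra_simps eval_nat_numeral split: nat.splits if_splits)

lemma local_representation_2: "local_representation 3 f2 g2"
  unfolding local_representation_def foliation_form_def homogeneous3_def f2_def g2_def
  \<comment> \<open>Here yB + zC = -x y^2 z^2, which forces A = y^2 z^2.\<close>
  by (rule exI[of _ "[:poly_mon 2 2:]"], rule exI[of _ "[:- (poly_mon 3 1 + poly_mon 0 4), - poly_mon 1 2:]"],
      rule exI[of _ "[:poly_mon 4 0 + poly_mon 1 3:]"])
    (auto simp: coeff_pCons algebra_simps eval_nat_numeral split: nat.splits if_splits)

lemma has_alg_multiplicity: "has_alg_multiplicity 3 f1 g1" "has_alg_multiplicity 3 f2 g2"
  by (auto simp: has_alg_multiplicity_def f1_def g1_def f2_def g2_def)

lemma family_G1_1_f1_g1: "family_G1_1 (\<lambda>h k r s. if (h, k, r, s) = (1, 3, 3, 1) then 1 else 0) f1 g1"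
  using local_representation_1 has_alg_multiplicity(1)
  by (auto simp: family_G1_1_def f1_def g1_def poly_mon_def)

lemma family_G2_f1_g1: "family_G2 (\<lambda>h k r s. if (h, k, r, s) = (3, 1, 1, 3) then 1 else 0) f1 g1"
  using local_representation_1 has_alg_multiplicity(1)
  by (auto simp: family_G2_def f1_def g1_def poly_mon_def)

text \<open>The cubic term -yz^2 of \<open>f2\<close> comes from the constant 1 in
  \<open>C 2 1 4 0 + 1\<close>, the coefficient itself being 0.\<close>

lemma family_G1_2_f2_g2: "family_G1_2 (\<lambda>h k r s. if (h, k, r, s) = (1, 3, 4, 0) then 1 else 0) f2 g2"
  using local_representation_2 has_alg_multiplicity(2)
  by (auto simp: family_G1_2_def f2_def g2_def poly_mon_def)

text \<open>The monomials outside the monomial ideal generated by y^3, yz^3 and z^7.\<close>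

definition std_mons1 :: "(nat \<times> nat) list"
  where "std_mons1 = [(0,0), (0,1), (0,2), (0,3), (0,4), (0,5), (0,6), (1,0), (1,1), (1,2), (2,0), (2,1), (2,2)]"

text \<open>
  Coordinates of the normal form under the rules \<open>y\<^sup>3 \<rightarrow> -y\<^sup>2z\<^sup>2 - z\<^sup>4\<close>, \<open>yz\<^sup>3 \<rightarrow> z\<^sup>5\<close>, \<open>y\<^sup>3z \<rightarrow> -z\<^sup>5\<close> and
  the \<open>z\<close>-multiples of the last two.
\<close>

definition nf_coeff1 :: "complex fps fps \<Rightarrow> nat \<times> nat \<Rightarrow> complex"
  where "nf_coeff1 F p = fps_nth (fps_nth F (fst p)) (snd p) +
    (if p = (0,4) \<or> p = (2,2) then - fps_nth (fps_nth F 3) 0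
     else if p = (0,5) then fps_nth (fps_nth F 1) 3 - fps_nth (fps_nth F 3) 1
     else if p = (0,6) then fps_nth (fps_nth F 1) 4 - fps_nth (fps_nth F 3) 2
     else 0)"

text \<open>The monomials outside the monomial ideal generated by y^4, yz^2 and z^7.\<close>

definition std_mons2 :: "(nat \<times> nat) list"
  where "std_mons2 = [(0,0), (0,1), (0,2), (0,3), (0,4), (0,5), (0,6), (1,0), (1,1), (2,0), (2,1), (3,0), (3,1)]"

text \<open>
  Here the rules are \<open>yz\<^sup>2 \<rightarrow> -y\<^sup>3z - z\<^sup>4\<close>, \<open>yz\<^sup>3 \<rightarrow> -z\<^sup>5\<close>, \<open>y\<^sup>4 \<rightarrow> z\<^sup>5\<close> and the \<open>z\<close>-multiples of
  the last two.
\<close>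

definition nf_coeff2 :: "complex fps fps \<Rightarrow> nat \<times> nat \<Rightarrow> complex"
  where "nf_coeff2 F p = fps_nth (fps_nth F (fst p)) (snd p) +
    (if p = (0,4) \<or> p = (3,1) then - fps_nth (fps_nth F 1) 2
     else if p = (0,5) then fps_nth (fps_nth F 4) 0 - fps_nth (fps_nth F 1) 3
     else if p = (0,6) then fps_nth (fps_nth F 4) 1 - fps_nth (fps_nth F 1) 4
     else 0)"

text \<open>The first three members justify the rewriting rules behind \<open>nf_coeff1\<close>; the
  last four generate the monomial ideal that absorbs all monomials which are neither standard nor
  rewritten.\<close>

lemma reductions_1:
  defines "J \<equiv> combinations (germ f1) (germ g1)"
  shows "germ_mon 3 0 + germ_mon 2 2 + germ_mon 0 4 \<in> J" "germ_mon 1 3 - germ_mon 0 5 \<in> J" "germ_mon 3 1 + germ_mon 0 5 \<in> J"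
    "germ_mon 4 0 \<in> J" "germ_mon 2 3 \<in> J" "germ_mon 1 5 \<in> J" "germ_mon 0 7 \<in> J"
proof -
  have germs: "germ f1 = - (germ_mon 3 0 + germ_mon 2 2 + germ_mon 0 4)" "germ g1 = germ_mon 3 1 + germ_mon 1 3"
    by (simp_all add: f1_def g1_def)
  show "germ_mon 3 0 + germ_mon 2 2 + germ_mon 0 4 \<in> J"
    unfolding J_def by (rule combinationsI[of "-1" 0]) (simp_all add: germs)
  \<comment> \<open>One has z f1 + g1 = yz^3 - z^5 - y^2 z^3; the remaining parts of the cofactors
    form the combination that equals y^2 z^3.\<close>
  show *: "germ_mon 1 3 - germ_mon 0 5 \<in> J"
    unfolding J_def by (rule combinationsI[of "germ_mon 0 1 + germ_mon 1 1" "1 + germ_mon 1 0 + germ_mon 0 2"])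
      (simp_all add: germs algebra_simps germ_mon_mult eval_nat_numeral)
  have "germ g1 \<in> J"
    unfolding J_def by (rule combinationsI[of 0 1]) simp_all
  then have "germ g1 - (germ_mon 1 3 - germ_mon 0 5) \<in> J"
    using * unfolding J_def by (rule combinations_diff)
  then show "germ_mon 3 1 + germ_mon 0 5 \<in> J"
    by (simp add: germs)
  \<comment> \<open>At x = 1 the relation xA + yB + zC = 0 reads A = -y f1 - z g1, and A is
    y^4.\<close>
  show "germ_mon 4 0 \<in> J"
    unfolding J_def by (rule combinationsI[of "- germ_mon 1 0" "- germ_mon 0 1"])
      (simp_all add: germs algebra_simps germ_mon_mult eval_nat_numeral)
  \<comment> \<open>This is y g1 - z y^4, with y^4 expressed through \<open>f1\<close> and
    \<open>g1\<close>.\<close>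
  show **: "germ_mon 2 3 \<in> J"
    unfolding J_def by (rule combinationsI[of "germ_mon 1 1" "germ_mon 1 0 + germ_mon 0 2"])
      (simp_all add: germs algebra_simps germ_mon_mult eval_nat_numeral)
  have "germ_mon 2 3 - germ_mon 1 0 * (germ_mon 1 3 - germ_mon 0 5) \<in> J"
    using combinations_diff[OF **[unfolded J_def] combinations_mult[OF *[unfolded J_def]]]
    unfolding J_def by simp
  then show ***: "germ_mon 1 5 \<in> J"
    by (simp add: algebra_simps germ_mon_mult eval_nat_numeral)
  have "germ_mon 1 5 - germ_mon 0 2 * (germ_mon 1 3 - germ_mon 0 5) \<in> J"
    using combinations_diff[OF ***[unfolded J_def] combinations_mult[OF *[unfolded J_def]]]
    unfolding J_def by simp
  then show "germ_mon 0 7 \<in> J"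
    by (simp add: algebra_simps germ_mon_mult eval_nat_numeral)
qed

text \<open>Again the chain starts from xA + yB + zC = 0 at x = 1, now giving y^2 z^2 = -y f2 - z
  g2. Cancelling with it in -z f2, and then in g2, yields the two rules with z^5; multiples of these
  rules yield the pure monomials.\<close>

lemma reductions_2:
  defines "J \<equiv> combinations (germ f2) (germ g2)"
  shows "germ_mon 1 2 + germ_mon 3 1 + germ_mon 0 4 \<in> J" "germ_mon 1 3 + germ_mon 0 5 \<in> J" "germ_mon 4 0 - germ_mon 0 5 \<in> J"
    "germ_mon 2 2 \<in> J" "germ_mon 5 0 \<in> J" "germ_mon 1 5 \<in> J" "germ_mon 0 7 \<in> J"
proof -
  have germs: "germ f2 = - (germ_mon 1 2 + germ_mon 3 1 + germ_mon 0 4)" "germ g2 = germ_mon 4 0 + germ_mon 1 3"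
    by (simp_all add: f2_def g2_def)
  have f: "- germ f2 \<in> J" and g: "germ g2 \<in> J"
    unfolding J_def by (rule combinationsI[of "-1" 0] combinationsI[of 0 1]; simp)+
  show "germ_mon 1 2 + germ_mon 3 1 + germ_mon 0 4 \<in> J"
    using f by (simp add: germs algebra_simps)
  show *: "germ_mon 2 2 \<in> J"
    unfolding J_def by (rule combinationsI[of "- germ_mon 1 0" "- germ_mon 0 1"])
      (simp_all add: germs algebra_simps germ_mon_mult eval_nat_numeral)
  have "germ_mon 0 1 * - germ f2 - germ_mon 1 0 * germ_mon 2 2 \<in> J"
    using * f unfolding J_def by (intro combinations_diff combinations_mult) auto
  then show **: "germ_mon 1 3 + germ_mon 0 5 \<in> J"
    by (simp add: germs algebra_simps germ_mon_mult eval_nat_numeral)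
  have "germ g2 - (germ_mon 1 3 + germ_mon 0 5) \<in> J"
    using ** g unfolding J_def by (intro combinations_diff)
  then show ***: "germ_mon 4 0 - germ_mon 0 5 \<in> J"
    by (simp add: germs)
  have "germ_mon 1 0 * (germ_mon 1 3 + germ_mon 0 5) - germ_mon 0 1 * germ_mon 2 2 \<in> J"
    using * ** unfolding J_def by (intro combinations_diff combinations_mult) auto
  then show 15: "germ_mon 1 5 \<in> J"
    by (simp add: algebra_simps germ_mon_mult eval_nat_numeral)
  have "germ_mon 0 2 * (germ_mon 1 3 + germ_mon 0 5) - germ_mon 1 5 \<in> J"
    using ** 15 unfolding J_def by (intro combinations_diff combinations_mult) auto
  then show "germ_mon 0 7 \<in> J"
    by (simp add: algebra_simps germ_mon_mult eval_nat_numeral)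
  have "germ_mon 1 0 * (germ_mon 4 0 - germ_mon 0 5) + germ_mon 1 5 \<in> J"
    using combinations_add[OF combinations_mult[OF ***[unfolded J_def]] 15[unfolded J_def]]
    unfolding J_def by simp
  then show "germ_mon 5 0 \<in> J"
    by (simp add: algebra_simps germ_mon_mult eval_nat_numeral)
qed

section \<open>Computation of the two intersection indices\<close>

lemma index_1: "I\<^sub>0 f1 g1 = 13"
proof -
  let ?J = "combinations (germ f1) (germ g1)"
  have germs: "germ f1 = - (germ_mon 3 0 + germ_mon 2 2 + germ_mon 0 4)" "germ g1 = germ_mon 3 1 + germ_mon 1 3"
    by (simp_all add: f1_def g1_def)
  have "I\<^sub>0 f1 g1 = enat (length std_mons1)"
  proof (rule intersection_index_eqI[where \<phi> = nf_coeff1])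
    fix c q assume "q \<in> set std_mons1"
    \<comment> \<open>The corrections in \<open>nf_coeff1\<close> read only nonstandard monomials,
      whose coefficients are 0 in a combination of standard ones.\<close>
    then show "nf_coeff1 (\<Sum>(i, j)\<leftarrow>std_mons1. germ_const (c (i, j)) * germ_mon i j) q = c q"
      by (subst nf_coeff1_def, subst (1 2 3 4 5 6) nth_sum_list_germ_mon) (auto simp: std_mons1_def)
  next
    fix a b q assume "q \<in> set std_mons1"
    \<comment> \<open>Each coordinate is a finite identity between coefficients of \<open>a\<close>
      and \<open>b\<close>. The deleted rules would expand low-order coefficients of products, which
      \<open>nth_mult_germ_mon\<close> is to read off as shifts.\<close>
    then show "nf_coeff1 (a * germ f1 + b * germ g1) q = 0"
      unfolding germs mult_minus_right distrib_left std_mons1_def list.set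
      by (elim insertE emptyE; hypsubst; simp add: nf_coeff1_def del: fps_mult_nth_0 fps_mult_nth_1')
  next
    fix F assume F: "convergent_series F"
    let ?c = "\<lambda>i j. fps_nth (fps_nth F i) j"
    \<comment> \<open>Besides \<open>std_mons1\<close>, this staircase contains yz^3, yz^4, y^3, y^3
      z and y^3 z^2, which are the monomials that the rules rewrite.\<close>
    define n :: "nat \<Rightarrow> nat" where "n = (!) [7, 5, 3, 3]"
    have "germ_mon 1 0 * germ_mon 2 3 \<in> ?J"
      by (intro combinations_mult reductions_1) auto
    then have 33: "germ_mon 3 3 \<in> ?J"
      by (simp add: germ_mon_mult eval_nat_numeral)
    have "germ_mon i (n i) \<in> ?J" if "i < 4" for i
    proof -
      have "i = 0 \<or> i = 1 \<or> i = 2 \<or> i = 3" using that by auto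
      then show ?thesis using 33 reductions_1(5-7) by (auto simp: n_def)
    qed
    then have 1: "F - (\<Sum>i<4. \<Sum>j<n i. germ_const (?c i j) * germ_mon i j) \<in> ?J"
      by (intro staircase_remainder F reductions_1)
    \<comment> \<open>Each nonstandard coefficient multiplies the relation that rewrites its
      monomial, so this element is the truncation of \<open>F\<close> minus its normal form.\<close>
    have 2: "germ_const (?c 3 0) * (germ_mon 3 0 + germ_mon 2 2 + germ_mon 0 4)
        + (germ_const (?c 1 3) + germ_const (?c 1 4) * germ_mon 0 1) * (germ_mon 1 3 - germ_mon 0 5)
        + (germ_const (?c 3 1) + germ_const (?c 3 2) * germ_mon 0 1) * (germ_mon 3 1 + germ_mon 0 5) \<in> ?J"
      by (intro combinations_add combinations_mult reductions_1) auto
    have "F - (\<Sum>(i, j)\<leftarrow>std_mons1. germ_const (nf_coeff1 F (i, j)) * germ_mon i j) =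
      (F - (\<Sum>i<4. \<Sum>j<n i. germ_const (?c i j) * germ_mon i j)) +
      (germ_const (?c 3 0) * (germ_mon 3 0 + germ_mon 2 2 + germ_mon 0 4)
        + (germ_const (?c 1 3) + germ_const (?c 1 4) * germ_mon 0 1) * (germ_mon 1 3 - germ_mon 0 5)
        + (germ_const (?c 3 1) + germ_const (?c 3 2) * germ_mon 0 1) * (germ_mon 3 1 + germ_mon 0 5))"
      by (simp add: n_def std_mons1_def nf_coeff1_def lessThan_nat_numeral germ_const_simps algebra_simps germ_mon_mult germ_mon_mult_left)
        (simp add: numeral_2_eq_2)
    then show "F - (\<Sum>(i, j)\<leftarrow>std_mons1. germ_const (nf_coeff1 F (i, j)) * germ_mon i j) \<in> ?J"
      using combinations_add[OF 1 2] by (simp only:)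
  qed (auto simp: std_mons1_def f1_def g1_def)
  then show ?thesis by (simp add: std_mons1_def numeral_eq_enat)
qed

lemma index_2: "I\<^sub>0 f2 g2 = 13"
proof -
  let ?J = "combinations (germ f2) (germ g2)"
  have germs: "germ f2 = - (germ_mon 1 2 + germ_mon 3 1 + germ_mon 0 4)" "germ g2 = germ_mon 4 0 + germ_mon 1 3"
    by (simp_all add: f2_def g2_def)
  have "I\<^sub>0 f2 g2 = enat (length std_mons2)"
  proof (rule intersection_index_eqI[where \<phi> = nf_coeff2])
    fix c q assume "q \<in> set std_mons2"
    then show "nf_coeff2 (\<Sum>(i, j)\<leftarrow>std_mons2. germ_const (c (i, j)) * germ_mon i j) q = c q"
      by (subst nf_coeff2_def, subst (1 2 3 4 5 6) nth_sum_list_germ_mon) (auto simp: std_mons2_def)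
  next
    fix a b q assume "q \<in> set std_mons2"
    then show "nf_coeff2 (a * germ f2 + b * germ g2) q = 0"
      unfolding germs mult_minus_right distrib_left std_mons2_def list.set
      by (elim insertE emptyE; hypsubst; simp add: nf_coeff2_def del: fps_mult_nth_0 fps_mult_nth_1')
  next
    fix F assume F: "convergent_series F"
    let ?c = "\<lambda>i j. fps_nth (fps_nth F i) j"
    \<comment> \<open>The monomials below this staircase outside \<open>std_mons2\<close> are yz^2,
      yz^3, yz^4, y^4 and y^4 z, again those rewritten by the rules.\<close>
    define n :: "nat \<Rightarrow> nat" where "n = (!) [7, 5, 2, 2, 2]"
    have "germ_mon 1 0 * germ_mon 2 2 \<in> ?J" "germ_mon 2 0 * germ_mon 2 2 \<in> ?J"
      by (intro combinations_mult reductions_2; simp)+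
    then have 32: "germ_mon 3 2 \<in> ?J" "germ_mon 4 2 \<in> ?J"
      by (simp_all add: germ_mon_mult eval_nat_numeral)
    have "germ_mon i (n i) \<in> ?J" if "i < 5" for i
    proof -
      have "i = 0 \<or> i = 1 \<or> i = 2 \<or> i = 3 \<or> i = 4" using that by auto
      then show ?thesis using 32 reductions_2(4,6,7) by (auto simp: n_def)
    qed
    then have 1: "F - (\<Sum>i<5. \<Sum>j<n i. germ_const (?c i j) * germ_mon i j) \<in> ?J"
      by (intro staircase_remainder F reductions_2)
    have 2: "germ_const (?c 1 2) * (germ_mon 1 2 + germ_mon 3 1 + germ_mon 0 4)
        + (germ_const (?c 1 3) + germ_const (?c 1 4) * germ_mon 0 1) * (germ_mon 1 3 + germ_mon 0 5)
        + (germ_const (?c 4 0) + germ_const (?c 4 1) * germ_mon 0 1) * (germ_mon 4 0 - germ_mon 0 5) \<in> ?J"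
      by (intro combinations_add combinations_mult reductions_2) auto
    have "F - (\<Sum>(i, j)\<leftarrow>std_mons2. germ_const (nf_coeff2 F (i, j)) * germ_mon i j) =
      (F - (\<Sum>i<5. \<Sum>j<n i. germ_const (?c i j) * germ_mon i j)) +
      (germ_const (?c 1 2) * (germ_mon 1 2 + germ_mon 3 1 + germ_mon 0 4)
        + (germ_const (?c 1 3) + germ_const (?c 1 4) * germ_mon 0 1) * (germ_mon 1 3 + germ_mon 0 5)
        + (germ_const (?c 4 0) + germ_const (?c 4 1) * germ_mon 0 1) * (germ_mon 4 0 - germ_mon 0 5))"
      by (simp add: n_def std_mons2_def nf_coeff2_def lessThan_nat_numeral germ_const_simps algebra_simps germ_mon_mult germ_mon_mult_left)
    then show "F - (\<Sum>(i, j)\<leftarrow>std_mons2. germ_const (nf_coeff2 F (i, j)) * germ_mon i j) \<in> ?J"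
      using combinations_add[OF 1 2] by (simp only:)
  qed (auto simp: std_mons2_def f2_def g2_def)
  then show ?thesis by (simp add: std_mons2_def numeral_eq_enat)
qed

theorem theorem6p2:
  shows "\<forall>family \<in> {family_G1_1, family_G1_2, family_G2}.
    \<exists>C f g. family C f g \<and>
      hom_part 3 g = 0 \<and>
      f = hom_part 4 f + hom_part 3 f \<and>
      g = hom_part 4 g \<and>
      hom_part 3 f \<noteq> 0 \<and>
      I\<^sub>0 f g = 13"
proof -
  have "hom_part 3 g1 = 0 \<and> f1 = hom_part 4 f1 + hom_part 3 f1 \<and> g1 = hom_part 4 g1 \<and>
      hom_part 3 f1 \<noteq> 0 \<and> I\<^sub>0 f1 g1 = 13"
    \<comment> \<open>The index is replaced by 13 before the simplifier unfolds the pair.\<close>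
    unfolding index_1 by (simp add: f1_def g1_def)
  moreover have "hom_part 3 g2 = 0 \<and> f2 = hom_part 4 f2 + hom_part 3 f2 \<and> g2 = hom_part 4 g2 \<and>
      hom_part 3 f2 \<noteq> 0 \<and> I\<^sub>0 f2 g2 = 13"
    unfolding index_2 by (simp add: f2_def g2_def)
  ultimately show ?thesis
    using family_G1_1_f1_g1 family_G2_f1_g1 family_G1_2_f2_g2 by blast
qed

end
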